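(* We have \[ \mathcal{C}_3(1,2)\supset\mathcal{C}_3(1,3)=\mathcal{C}_3(2,3)=\{n^2 : n\in\mathbb{Z}^+\}. \]
   Context: Orthogonality and the norm refer to the standard Euclidean inner product. $\mathbb{Z}^+$ is the set of positive integers. For positive integers $d,N,n$, $\mathcal{O}_d(N,n)$ denotes the collection of sets $\mathcal{S}\subset\mathbb{Z}^d$ of (pairwise) orthogonal vectors of norm $\sqrt{N}$ with $\#\mathcal{S}=n$. For $1\le n_1<n_2\le d$, \[ \mathcal{C}_d(n_1,n_2)=\big\{N\in\mathbb{Z}^+ : \forall\, \mathcal{S}\in\mathcal{O}_d(N,n_1)\ \exists\, \mathcal{S}'\in\mathcal{O}_d(N,n_2)\text{ with }\mathcal{S}'\supset\mathcal{S}\big\}. \] The symbol $\supset$ denotes inclusion.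
   Formalization: The classes C_d(n_1,n_2) are restricted to N for which O_d(N,n_1) is nonempty; read literally the claim fails, e.g. 7 is not a sum of three squares and so lies vacuously in C_3(1,3) and C_3(2,3), though it is not a square. *)

theory Defs
  imports "HOL-Analysis.Analysis"
begin

definition int_lattice :: "(real ^ 'd::finite) set" where
  "int_lattice = {v. \<forall>i. v $ i \<in> \<int>}"

definition orth_sets :: "nat \<Rightarrow> nat \<Rightarrow> (real ^ 'd::finite) set set" where
  "orth_sets N n =
     {S. S \<subseteq> int_lattice \<and> finite S \<and> card S = n \<and>
         (\<forall>v\<in>S. norm v = sqrt (real N)) \<and> pairwise orthogonal S}"

text \<open>
  The class \<open>C\<^sub>d(n1, n2)\<close>, where the dimension \<open>d\<close> is the cardinality of the index type and
  is passed as a type argument. Only those \<open>N\<close> are admitted for which there is something to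
  extend: without the condition that \<^term>\<open>orth_sets N n1\<close> is nonempty, vacuous members
  would enter. For instance, 7 is not a sum of three squares, so it would
  belong to \<open>C\<^sub>3(1, 3)\<close> and \<open>C\<^sub>3(2, 3)\<close>; and no two integer vectors of norm
  \<open>sqrt 3\<close> in dimension 3 are orthogonal, so 3 would belong to \<open>C\<^sub>3(2, 3)\<close>
  but not to \<open>C\<^sub>3(1, 3)\<close>.
\<close>

definition ext_class :: "'d::finite itself \<Rightarrow> nat \<Rightarrow> nat \<Rightarrow> nat set" where
  "ext_class (_ :: 'd::finite itself) n1 n2 =
     {N. N > 0 \<and> (orth_sets N n1 :: (real ^ 'd) set set) \<noteq> {} \<and>
         (\<forall>S \<in> (orth_sets N n1 :: (real ^ 'd) set set). \<exists>S' \<in> orth_sets N n2. S \<subseteq> S')}"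

end

theory Submission
  imports Defs
begin

text \<open>
  An orthogonal triple of integer vectors of norm \<open>sqrt N\<close> has determinant \<open>D\<close> with
  \<open>D\<^sup>2 = N\<^sup>3\<close>, so \<open>N\<close> is a square. Now let \<open>N = n\<^sup>2\<close>. Two orthogonal vectors \<open>u\<close>, \<open>v\<close> of norm \<open>n\<close>
  are completed by \<open>(u \<times> v) / n\<close>: each coordinate of \<open>u \<times> v\<close> has square
  \<open>n\<^sup>2 (n\<^sup>2 - u\<^sub>i\<^sup>2 - v\<^sub>i\<^sup>2)\<close>, hence is divisible by \<open>n\<close>. For a single vector \<open>(x, y, z)\<close> of norm \<open>n\<close>, the
  Hermitian matrix with diagonal \<open>n + x, n - x\<close> and off-diagonal entry \<open>y + iz\<close> is positive
  semidefinite and singular, so by Euclidean descent in the Gaussian integers it is an integer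
  multiple \<open>g\<close> of the rank one matrix given by a vector \<open>(a + ib, c + id)\<close>. The
  Euler--Rodrigues matrix of the quaternion \<open>(a, b, c, d)\<close>, scaled by \<open>g / 2\<close>, is then integral and has
  \<open>(x, y, z)\<close> as its first row, up to the order of coordinates.
\<close>

section \<open>Descent for singular Hermitian matrices over the Gaussian integers\<close>

lemma int_round_div:
  fixes y B :: int
  assumes "B > 0"
  obtains q where "2 * \<bar>y - q * B\<bar> \<le> B"
proof
  \<comment> \<open>Adding \<open>B\<close> turns floor division into rounding, so
    \<open>m - B\<close> is twice the centred remainder.\<close>
  define m where "m = (2 * y + B) mod (2 * B)"
  have "2 * (y - (2 * y + B) div (2 * B) * B) = m - B"
    using div_mult_mod_eq[of "2 * y + B" "2 * B"] by (simp add: m_def algebra_simps)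
  moreover have "0 \<le> m" "m < 2 * B"
    using assms by (simp_all add: m_def)
  ultimately show "2 * \<bar>y - (2 * y + B) div (2 * B) * B\<bar> \<le> B"
    by linarith
qed

text \<open>With \<alpha> = a + ib and \<gamma> = c + id, the off-diagonal entry y + iz is g
  \<alpha> times the conjugate of \<gamma>. Subtracting a Gaussian multiple of one basis vector from
  the other keeps the determinant zero and can lower the trace \<open>A + B\<close>, on which the
  induction runs.\<close>

lemma rank_one_hermitian_gaussian:
  fixes A B y z :: int
  assumes "A \<ge> 0" "B \<ge> 0" "A * B = y\<^sup>2 + z\<^sup>2"
  shows "\<exists>g a b c d. A = g * (a\<^sup>2 + b\<^sup>2) \<and> B = g * (c\<^sup>2 + d\<^sup>2) \<and>
           y = g * (a * c + b * d) \<and> z = g * (b * c - a * d)"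
  using assms
proof (induction "nat (A + B)" arbitrary: A B y z rule: less_induct)
  case (less A B y z)
  \<comment> \<open>With only the trace fixed, \<open>descent\<close> can be applied to either order
    of the diagonal entries.\<close>
  define k where "k = nat (A + B)"
  have descent: "\<exists>g a b c d. A = g * (a\<^sup>2 + b\<^sup>2) \<and> B = g * (c\<^sup>2 + d\<^sup>2) \<and>
           y = g * (a * c + b * d) \<and> z = g * (b * c - a * d)"
    if "nat (A + B) = k" "B \<le> A" "B \<ge> 0" and AB: "A * B = y\<^sup>2 + z\<^sup>2" for A B y z :: int
  proof (cases "B = 0")
    case True
    with AB have "y = 0" "z = 0" by (simp_all add: sum_power2_eq_zero_iff)
    with True show ?thesis
      by (intro exI[of _ A] exI[of _ 1] exI[of _ 0]) simp
  next
    case False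
    with \<open>B \<ge> 0\<close> have "B > 0" by simp
    obtain q r where q: "2 * \<bar>y - q * B\<bar> \<le> B" and r: "2 * \<bar>z - r * B\<bar> \<le> B"
      using int_round_div[OF \<open>B > 0\<close>] by metis
    \<comment> \<open>Row and column operation with multiplier q + ir, a Gaussian integer nearest to
      (y + iz) / B; \<open>A'\<close> is the new diagonal entry. The rounding bounds give A' \<le>
      B/2 < B \<le> A, so the trace drops.\<close>
    define y' z' where "y' = y - q * B" and "z' = z - r * B"
    define A' where "A' = A - 2 * (q * y + r * z) + (q\<^sup>2 + r\<^sup>2) * B"
    have A'B: "A' * B = y'\<^sup>2 + z'\<^sup>2"
      using AB unfolding A'_def y'_def z'_def by algebra
    have "(2 * \<bar>y'\<bar>)\<^sup>2 \<le> B\<^sup>2" "(2 * \<bar>z'\<bar>)\<^sup>2 \<le> B\<^sup>2"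
      using q r unfolding y'_def z'_def by (intro power_mono; simp)+
    hence "4 * (A' * B) \<le> 2 * (B * B)"
      unfolding A'B by (simp add: power2_eq_square)
    hence "2 * A' \<le> B" using \<open>B > 0\<close> by simp
    have "A' * B \<ge> 0" unfolding A'B by simp
    hence "A' \<ge> 0" using \<open>B > 0\<close> by (simp add: zero_le_mult_iff)
    have "nat (A' + B) < nat (A + B)"
      using \<open>2 * A' \<le> B\<close> \<open>B \<le> A\<close> \<open>B > 0\<close> by linarith
    with \<open>nat (A + B) = k\<close> obtain g a b c d where
      IH: "A' = g * (a\<^sup>2 + b\<^sup>2)" "B = g * (c\<^sup>2 + d\<^sup>2)"
          "y' = g * (a * c + b * d)" "z' = g * (b * c - a * d)"
      using less.hyps[OF _ \<open>A' \<ge> 0\<close> \<open>B \<ge> 0\<close> A'B] unfolding k_def by metis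
    have y: "y = y' + q * B" and z: "z = z' + r * B" by (simp_all add: y'_def z'_def)
    have A: "A = A' + 2 * (q * y' + r * z') + (q\<^sup>2 + r\<^sup>2) * B"
      unfolding A'_def y'_def z'_def by algebra
    show ?thesis
    proof (intro exI conjI)
      \<comment> \<open>Undoing the operation replaces \<alpha> by \<alpha> + (q + ir) \<gamma> and
        keeps \<gamma>.\<close>
      show "A = g * ((a + q * c - r * d)\<^sup>2 + (b + q * d + r * c)\<^sup>2)"
        unfolding A IH by algebra
      show "B = g * (c\<^sup>2 + d\<^sup>2)" by (fact IH)
      show "y = g * ((a + q * c - r * d) * c + (b + q * d + r * c) * d)"
        unfolding y IH by algebra
      show "z = g * ((b + q * d + r * c) * c - (a + q * c - r * d) * d)"
        unfolding z IH by algebra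
    qed
  qed
  show ?case
  proof (cases "B \<le> A")
    case True
    then show ?thesis using descent[of A B y z] less.prems by (simp add: k_def)
  next
    case False
    \<comment> \<open>Swapping the diagonal entries conjugates the off-diagonal one, hence the sign
      of \<open>z\<close>.\<close>
    then obtain g a b c d where "B = g * (a\<^sup>2 + b\<^sup>2)" "A = g * (c\<^sup>2 + d\<^sup>2)"
        "y = g * (a * c + b * d)" "- z = g * (b * c - a * d)"
      using descent[of B A y "- z"] less.prems by (auto simp: k_def algebra_simps)
    then show ?thesis
      by (intro exI[of _ g] exI[of _ c] exI[of _ d] exI[of _ a] exI[of _ b])
        (simp add: algebra_simps)
  qed
qed

section \<open>Orthogonal vectors and determinants in integer coordinates\<close>

lemma orthogonal_int_vector_same_norm:
  fixes x y z n :: int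
  assumes "n \<ge> 0" and eq: "x\<^sup>2 + y\<^sup>2 + z\<^sup>2 = n\<^sup>2"
  obtains x' y' z' where "x'\<^sup>2 + y'\<^sup>2 + z'\<^sup>2 = n\<^sup>2" "x * x' + y * y' + z * z' = 0"
proof -
  have "x\<^sup>2 \<le> n\<^sup>2" using eq by (smt (verit) zero_le_power2)
  hence "\<bar>x\<bar> \<le> n" using \<open>n \<ge> 0\<close> by (simp add: abs_le_square_iff[symmetric])
  moreover have "(n + x) * (n - x) = y\<^sup>2 + z\<^sup>2" using eq by algebra
  moreover from calculation have "n + x \<ge> 0" "n - x \<ge> 0" by linarith+
  ultimately obtain g a b c d where
    g: "n + x = g * (a\<^sup>2 + b\<^sup>2)" "n - x = g * (c\<^sup>2 + d\<^sup>2)"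
       "y = g * (a * c + b * d)" "z = g * (b * c - a * d)"
    using rank_one_hermitian_gaussian[of "n + x" "n - x" y z] by blast
  \<comment> \<open>The second Euler-Rodrigues row has a diagonal entry that must be halved. Before
    halving it differs from 2n by 2g(b^2 + d^2), so it is even.\<close>
  have "even (g * (a\<^sup>2 + b\<^sup>2) + g * (c\<^sup>2 + d\<^sup>2))" unfolding g[symmetric] by simp
  hence "even (g * (a\<^sup>2 - b\<^sup>2 + c\<^sup>2 - d\<^sup>2))" by auto
  then obtain h where h: "g * (a\<^sup>2 - b\<^sup>2 + c\<^sup>2 - d\<^sup>2) = 2 * h" by blast
  have n2: "2 * n = g * (a\<^sup>2 + b\<^sup>2 + c\<^sup>2 + d\<^sup>2)" and x2: "2 * x = g * (a\<^sup>2 + b\<^sup>2 - c\<^sup>2 - d\<^sup>2)"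
    using g(1,2) by algebra+
  show thesis
  proof
    \<comment> \<open>The witness is that second row with its last two coordinates swapped; doubled
      quantities keep the identities integral.\<close>
    have "4 * ((g * (b * c + a * d))\<^sup>2 + (g * (c * d - a * b))\<^sup>2) + (2 * h)\<^sup>2 = (2 * n)\<^sup>2"
      unfolding n2 h[symmetric] by algebra
    then show "(g * (b * c + a * d))\<^sup>2 + (g * (c * d - a * b))\<^sup>2 + h\<^sup>2 = n\<^sup>2"
      by simp
    have "(2 * x) * (g * (b * c + a * d)) + 2 * y * (g * (c * d - a * b)) + z * (2 * h) = 0"
      unfolding x2 g(3,4) h[symmetric] by algebra
    then show "x * (g * (b * c + a * d)) + y * (g * (c * d - a * b)) + z * h = 0"
      by simp
  qed
qed

lemma orthogonal_int_triple_completion: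
  fixes x y z x' y' z' n :: int
  assumes "n > 0" and u: "x\<^sup>2 + y\<^sup>2 + z\<^sup>2 = n\<^sup>2" and v: "x'\<^sup>2 + y'\<^sup>2 + z'\<^sup>2 = n\<^sup>2"
    and uv: "x * x' + y * y' + z * z' = 0"
  obtains p q r where "p\<^sup>2 + q\<^sup>2 + r\<^sup>2 = n\<^sup>2"
    "x * p + y * q + z * r = 0" "x' * p + y' * q + z' * r = 0"
proof -
  have dvd: "n dvd b * c' - c * b'"
    if u: "a\<^sup>2 + b\<^sup>2 + c\<^sup>2 = n\<^sup>2" and v: "a'\<^sup>2 + b'\<^sup>2 + c'\<^sup>2 = n\<^sup>2" and uv: "a * a' + b * b' + c * c' = 0"
    for a b c a' b' c' :: int
  proof -
    \<comment> \<open>By Lagrange's identity the square is (n^2 - a^2)(n^2 - a'^2) - (a a')^2, where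
      the terms without a factor n^2 cancel.\<close>
    have "(b * c' - c * b')\<^sup>2 = n\<^sup>2 * (n\<^sup>2 - a\<^sup>2 - a'\<^sup>2)"
      using u v uv by algebra
    hence "n\<^sup>2 dvd (b * c' - c * b')\<^sup>2" by simp
    thus ?thesis by simp
  qed
  obtain p where p: "y * z' - z * y' = n * p" using dvd[OF u v uv] by blast
  obtain q where q: "z * x' - x * z' = n * q"
    using dvd[of y z x y' z' x'] u v uv by (auto simp only: dvd_def add.assoc add.commute add.left_commute)
  obtain r where r: "x * y' - y * x' = n * r"
    using dvd[of z x y z' x' y'] u v uv by (auto simp only: dvd_def add.assoc add.commute add.left_commute)
  show thesis
  proof
    have "n\<^sup>2 * (p\<^sup>2 + q\<^sup>2 + r\<^sup>2) = n\<^sup>2 * n\<^sup>2" using p q r u v uv by algebra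
    then show "p\<^sup>2 + q\<^sup>2 + r\<^sup>2 = n\<^sup>2" using \<open>n > 0\<close> by (subst (asm) mult_cancel_left) simp
    have "n * (x * p + y * q + z * r) = 0" using p q r by algebra
    then show "x * p + y * q + z * r = 0" using \<open>n > 0\<close> by simp
    have "n * (x' * p + y' * q + z' * r) = 0" using p q r by algebra
    then show "x' * p + y' * q + z' * r = 0" using \<open>n > 0\<close> by simp
  qed
qed

text \<open>The base of the square is the determinant of the three vectors. Its square is their Gram
  determinant, and the Gram matrix is N times the identity.\<close>

lemma gram_det_3:
  fixes x y z x' y' z' p q r N :: int
  assumes "x\<^sup>2 + y\<^sup>2 + z\<^sup>2 = N" "x'\<^sup>2 + y'\<^sup>2 + z'\<^sup>2 = N" "p\<^sup>2 + q\<^sup>2 + r\<^sup>2 = N"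
    and "x * x' + y * y' + z * z' = 0" "x * p + y * q + z * r = 0" "x' * p + y' * q + z' * r = 0"
  shows "(p * (y * z' - z * y') + q * (z * x' - x * z') + r * (x * y' - y * x'))\<^sup>2 = N ^ 3"
proof -
  have "(p * (y * z' - z * y') + q * (z * x' - x * z') + r * (x * y' - y * x'))\<^sup>2 =
    (x\<^sup>2 + y\<^sup>2 + z\<^sup>2) * (x'\<^sup>2 + y'\<^sup>2 + z'\<^sup>2) * (p\<^sup>2 + q\<^sup>2 + r\<^sup>2)
    + 2 * (x * x' + y * y' + z * z') * (x * p + y * q + z * r) * (x' * p + y' * q + z' * r)
    - (x\<^sup>2 + y\<^sup>2 + z\<^sup>2) * (x' * p + y' * q + z' * r)\<^sup>2
    - (x'\<^sup>2 + y'\<^sup>2 + z'\<^sup>2) * (x * p + y * q + z * r)\<^sup>2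
    - (p\<^sup>2 + q\<^sup>2 + r\<^sup>2) * (x * x' + y * y' + z * z')\<^sup>2"
    by algebra
  then show ?thesis by (simp add: assms power3_eq_cube)
qed

text \<open>N^2 divides D^2, so N divides D, and the quotient squares to N.\<close>

lemma square_if_cube_eq_square:
  fixes N :: nat and D :: int
  assumes "N > 0" "D\<^sup>2 = int N ^ 3"
  obtains n where "n > 0" "N = n\<^sup>2"
proof -
  have "int N ^ 2 dvd D ^ 2" unfolding assms(2) by (rule le_imp_power_dvd) simp
  then obtain k where k: "D = int N * k" by auto
  with assms have "int N = k\<^sup>2" by (simp add: power2_eq_square power3_eq_cube)
  hence "int N = int ((nat \<bar>k\<bar>)\<^sup>2)" by simp
  hence "N = (nat \<bar>k\<bar>)\<^sup>2" by (simp only: of_nat_eq_iff)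
  with assms(1) that[of "nat \<bar>k\<bar>"] show thesis by (cases "k = 0") auto
qed

section \<open>Passage from polynomial equations over \<open>int\<close> to lattice vectors\<close>

definition int_vec3 :: "int \<Rightarrow> int \<Rightarrow> int \<Rightarrow> real ^ 3" where
  "int_vec3 x y z = vector [of_int x, of_int y, of_int z]"

lemma int_vec3_in_lattice [simp]: "int_vec3 x y z \<in> int_lattice"
  by (simp add: int_lattice_def int_vec3_def forall_3)

lemma int_lattice_vec3E:
  assumes "u \<in> (int_lattice :: (real ^ 3) set)"
  obtains x y z where "u = int_vec3 x y z"
proof -
  have "u $ 1 \<in> \<int>" "u $ 2 \<in> \<int>" "u $ 3 \<in> \<int>"
    using assms by (auto simp: int_lattice_def)
  then obtain x y z where "u $ 1 = of_int x" "u $ 2 = of_int y" "u $ 3 = of_int z"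
    by (auto elim!: Ints_cases)
  then have "u = int_vec3 x y z"
    by (simp add: int_vec3_def vec_eq_iff forall_3)
  then show thesis by (rule that)
qed

lemma norm_int_vec3:
  "norm (int_vec3 x y z) = sqrt (real N) \<longleftrightarrow> x\<^sup>2 + y\<^sup>2 + z\<^sup>2 = int N"
proof -
  have "norm (int_vec3 x y z) = sqrt (of_int (x\<^sup>2 + y\<^sup>2 + z\<^sup>2))"
    by (simp add: int_vec3_def norm_vec_def L2_set_def sum_3)
  then show ?thesis by (metis of_int_eq_iff of_int_of_nat_eq real_sqrt_eq_iff)
qed

lemma norm_int_vec3_square:
  "norm (int_vec3 x y z) = sqrt (real (n\<^sup>2)) \<longleftrightarrow> x\<^sup>2 + y\<^sup>2 + z\<^sup>2 = (int n)\<^sup>2"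
  using norm_int_vec3[of x y z "n\<^sup>2"] by simp

lemma orthogonal_int_vec3:
  "orthogonal (int_vec3 x y z) (int_vec3 x' y' z') \<longleftrightarrow> x * x' + y * y' + z * z' = 0"
proof -
  have "int_vec3 x y z \<bullet> int_vec3 x' y' z' = of_int (x * x' + y * y' + z * z')"
    by (simp add: int_vec3_def inner_vec_def sum_3)
  then show ?thesis unfolding orthogonal_def by (simp only: of_int_eq_0_iff)
qed

section \<open>Extending orthogonal sets of lattice vectors\<close>

lemma orth_sets_insert:
  assumes S: "S \<in> orth_sets N n" and "N > 0" "w \<in> int_lattice" "norm w = sqrt (real N)"
    and orth: "\<And>v. v \<in> S \<Longrightarrow> orthogonal w v"
  shows "insert w S \<in> orth_sets N (Suc n)"
proof -
  \<comment> \<open>As N > 0, \<open>w\<close> is nonzero and not orthogonal to itself, so the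
    cardinality really grows.\<close>
  have "w \<notin> S" using orth[of w] assms(2,4) by (auto simp: orthogonal_self)
  then show ?thesis
    using assms by (auto simp: orth_sets_def pairwise_insert orthogonal_commute)
qed

lemma orth_sets_3_imp_square:
  assumes "N > 0" "S \<in> (orth_sets N 3 :: (real ^ 3) set set)"
  obtains n where "n > 0" "N = n\<^sup>2"
proof -
  from assms(2) obtain u v w where S: "S = {u, v, w}" "u \<noteq> v" "u \<noteq> w" "v \<noteq> w"
    unfolding orth_sets_def by (auto simp: card_3_iff)
  obtain x y z x' y' z' p q r where
    "u = int_vec3 x y z" "v = int_vec3 x' y' z'" "w = int_vec3 p q r"
    using assms(2) S(1) unfolding orth_sets_def by (auto elim!: int_lattice_vec3E)
  then have "(p * (y * z' - z * y') + q * (z * x' - x * z') + r * (x * y' - y * x'))\<^sup>2 = int N ^ 3"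
    using assms(2) S
    by (intro gram_det_3) (auto simp: orth_sets_def pairwise_insert norm_int_vec3 orthogonal_int_vec3)
  with assms(1) show thesis by (rule square_if_cube_eq_square) (rule that)
qed

lemma orth_sets_1_extend:
  assumes "n > 0" and S: "S \<in> (orth_sets (n\<^sup>2) 1 :: (real ^ 3) set set)"
  obtains S' where "S' \<in> orth_sets (n\<^sup>2) 2" "S \<subseteq> S'"
proof -
  from S obtain u where u: "S = {u}"
    unfolding orth_sets_def by (auto simp: card_1_singleton_iff)
  obtain x y z where xyz: "u = int_vec3 x y z"
    using S u by (auto simp: orth_sets_def elim: int_lattice_vec3E)
  have "x\<^sup>2 + y\<^sup>2 + z\<^sup>2 = (int n)\<^sup>2"
    using S unfolding u xyz orth_sets_def by (simp only: norm_int_vec3_square mem_Collect_eq ball_simps)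
  then obtain x' y' z' where v: "x'\<^sup>2 + y'\<^sup>2 + z'\<^sup>2 = (int n)\<^sup>2" "x * x' + y * y' + z * z' = 0"
    using orthogonal_int_vector_same_norm[of "int n" x y z] by auto
  have "insert (int_vec3 x' y' z') S \<in> orth_sets (n\<^sup>2) (Suc 1)"
    using S
  proof (rule orth_sets_insert)
    show "norm (int_vec3 x' y' z') = sqrt (real (n\<^sup>2))"
      using v(1) by (simp only: norm_int_vec3_square)
    show "orthogonal (int_vec3 x' y' z') w" if "w \<in> S" for w
      using that v(2) by (simp add: u xyz orthogonal_int_vec3 mult.commute)
  qed (use assms in auto)
  then show thesis using that by (simp add: numeral_2_eq_2 subset_insertI)
qed

lemma orth_sets_2_extend:
  assumes "n > 0" and S: "S \<in> (orth_sets (n\<^sup>2) 2 :: (real ^ 3) set set)"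
  obtains S' where "S' \<in> orth_sets (n\<^sup>2) 3" "S \<subseteq> S'"
proof -
  from S obtain u v where uv: "S = {u, v}" "u \<noteq> v"
    unfolding orth_sets_def by (auto simp: card_2_iff)
  obtain x y z x' y' z' where xyz: "u = int_vec3 x y z" "v = int_vec3 x' y' z'"
    using S uv(1) unfolding orth_sets_def by (auto elim!: int_lattice_vec3E)
  have "norm u = sqrt (real (n\<^sup>2))" "norm v = sqrt (real (n\<^sup>2))" "orthogonal u v"
    using S uv unfolding orth_sets_def by (auto simp: pairwise_insert)
  then have "x\<^sup>2 + y\<^sup>2 + z\<^sup>2 = (int n)\<^sup>2" "x'\<^sup>2 + y'\<^sup>2 + z'\<^sup>2 = (int n)\<^sup>2" "x * x' + y * y' + z * z' = 0"
    unfolding xyz by (simp_all only: norm_int_vec3_square orthogonal_int_vec3)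
  then obtain p q r where w: "p\<^sup>2 + q\<^sup>2 + r\<^sup>2 = (int n)\<^sup>2"
    "x * p + y * q + z * r = 0" "x' * p + y' * q + z' * r = 0"
    using orthogonal_int_triple_completion[of "int n"] \<open>n > 0\<close> by (metis of_nat_0_less_iff)
  have "insert (int_vec3 p q r) S \<in> orth_sets (n\<^sup>2) (Suc 2)"
    using S
  proof (rule orth_sets_insert)
    show "norm (int_vec3 p q r) = sqrt (real (n\<^sup>2))"
      using w(1) by (simp only: norm_int_vec3_square)
    show "orthogonal (int_vec3 p q r) t" if "t \<in> S" for t
      using that w(2,3) by (auto simp: uv xyz orthogonal_int_vec3 mult.commute)
  qed (use assms in auto)
  then show thesis using that by (simp add: subset_insertI)
qed

text \<open>Supplies the nonemptiness that \<open>ext_class\<close> demands.\<close>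

lemma orth_sets_1_nonempty:
  "{int_vec3 (int n) 0 0} \<in> orth_sets (n\<^sup>2) 1"
proof -
  have "norm (int_vec3 (int n) 0 0) = sqrt (real (n\<^sup>2))"
    by (simp only: norm_int_vec3_square) simp
  then show ?thesis by (simp add: orth_sets_def)
qed

theorem theorem4p3:
  "ext_class TYPE(3) 1 3 \<subseteq> ext_class TYPE(3) 1 2 \<and>
   ext_class TYPE(3) 1 3 = ext_class TYPE(3) 2 3 \<and>
   ext_class TYPE(3) 2 3 = {n ^ 2 | n :: nat. n > 0}"
proof -
  have square: "N \<in> {n ^ 2 | n :: nat. n > 0}" if "N \<in> ext_class TYPE(3) m 3" for N m
  proof -
    \<comment> \<open>Some set of size \<open>m\<close> exists, and its extension is an orthogonal
      triple; \<open>m\<close> is arbitrary to serve both classes.\<close>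
    from that have "N > 0" and "\<exists>S. S \<in> (orth_sets N 3 :: (real ^ 3) set set)"
      unfolding ext_class_def by auto
    then show ?thesis by (auto elim: orth_sets_3_imp_square)
  qed
  have members: "n\<^sup>2 \<in> ext_class TYPE(3) 1 2" "n\<^sup>2 \<in> ext_class TYPE(3) 1 3"
    "n\<^sup>2 \<in> ext_class TYPE(3) 2 3" if "n > 0" for n :: nat
  proof -
    have ne1: "(orth_sets (n\<^sup>2) 1 :: (real ^ 3) set set) \<noteq> {}"
      using orth_sets_1_nonempty[of n] by blast
    have ext1: "\<exists>S'\<in>orth_sets (n\<^sup>2) 2. S \<subseteq> S'" if "S \<in> orth_sets (n\<^sup>2) 1" for S :: "(real ^ 3) set"
      using orth_sets_1_extend[OF \<open>n > 0\<close> that] by blast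
    have ext2: "\<exists>S'\<in>orth_sets (n\<^sup>2) 3. S \<subseteq> S'" if "S \<in> orth_sets (n\<^sup>2) 2" for S :: "(real ^ 3) set"
      using orth_sets_2_extend[OF \<open>n > 0\<close> that] by blast
    \<comment> \<open>Pairs exist because a singleton extends to one.\<close>
    have ne2: "(orth_sets (n\<^sup>2) 2 :: (real ^ 3) set set) \<noteq> {}"
      using ne1 ext1 by blast
    have ext13: "\<exists>S'\<in>orth_sets (n\<^sup>2) 3. S \<subseteq> S'" if "S \<in> orth_sets (n\<^sup>2) 1" for S :: "(real ^ 3) set"
      using ext1[OF that] ext2 by (meson subset_trans)
    have "0 < n\<^sup>2" using that by simp
    then show "n\<^sup>2 \<in> ext_class TYPE(3) 1 2" "n\<^sup>2 \<in> ext_class TYPE(3) 1 3"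
      "n\<^sup>2 \<in> ext_class TYPE(3) 2 3"
      unfolding ext_class_def using ne1 ne2 ext1 ext2 ext13 by blast+
  qed
  show ?thesis using square members by blast
qed

end
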